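(* Let $\mathcal{H}$ be a Hilbert space, let $I$ be $\mathbb{N}$ or $\mathbb{Z}$, and suppose $\{f_n\}_{n\in I}\subseteq \mathcal{H}$ does frame reconstruction with $B\in B(\mathcal{H})$. Then: (1) $B$ is positive semi-definite, injective, and has dense range. (2) For all $f\in \mathcal{H}$, $$\sum_{n\in I}\langle f, f_n\rangle Bf_n=\sum_{n\in I}\langle Bf, f_n\rangle f_n=f,$$ with norm convergence, where the sums are limits of the partial sums $\sum_{n=0}^{M}$ if $I=\mathbb{N}$ and of the symmetric partial sums $\sum_{n=-M}^{M}$ if $I=\mathbb{Z}$. (3) For all $f\in \mathcal{H}$, $$\sum_{n\in I}|\langle f, Bf_n\rangle|^2\leq \|B\|\,\|f\|^2.$$ (4) For all $f\in \mathcal{H}$, $$\frac{1}{\|B\|}\|f\|^2\leq \sum_{n\in I}|\langle f, f_n\rangle|^2$$ (the right-hand side may be $+\infty$). (5) $\{\sqrt{B}f_n\}_{n\in I}$ is a Parseval frame for $\mathcal{H}$.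
   Context: $B(\mathcal{H})$ is the space of bounded linear operators on $\mathcal{H}$; inner products are linear in the first variable; $\mathbb{N}=\{0,1,2,\dots\}$. A sequence $\{f_n\}_{n\in I}\subseteq\mathcal{H}$ ($I=\mathbb{N}$ or $\mathbb{Z}$) does frame reconstruction with $B\in B(\mathcal{H})$ if for every $f\in\mathcal{H}$ one has $\sum_{n=0}^{\infty}\langle f,Bf_n\rangle f_n=f$ when $I=\mathbb{N}$, respectively $\lim_{M\to\infty}\sum_{n=-M}^{M}\langle f,Bf_n\rangle f_n=f$ when $I=\mathbb{Z}$, with convergence in norm (unconditional convergence is not assumed). Positive semi-definite means self-adjoint with $\langle Bf,f\rangle\ge 0$ for all $f$; $\sqrt{B}$ is the positive square root of $B$. $\{g_n\}$ is a Parseval frame for $\mathcal{H}$ if $\|f\|^2=\sum_n|\langle f,g_n\rangle|^2$ for all $f\in\mathcal{H}$. *)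

theory Defs
  imports "HOL-Analysis.Analysis"
begin

text \<open>
  The scalar field is \<open>\<real>\<close> or \<open>\<complex>\<close>. By the Gelfand--Mazur theorem these are, up to isomorphism,
  the only real normed fields; the two axioms below force \<open>scalar_cnj\<close> to be the identity on
  \<open>\<real>\<close> and complex conjugation on \<open>\<complex>\<close>.
\<close>

class real_or_complex = real_normed_field +
  fixes scalar_cnj :: "'a \<Rightarrow> 'a"
  assumes scalar_cnj_add: "scalar_cnj (x + y) = scalar_cnj x + scalar_cnj y"
    and mult_scalar_cnj: "x * scalar_cnj x = (norm x)\<^sup>2 *\<^sub>R 1"

instantiation real :: real_or_complex
begin
definition scalar_cnj_real :: "real \<Rightarrow> real" where "scalar_cnj_real x = x"
instance by standard (simp_all add: scalar_cnj_real_def power2_eq_square)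
end

instantiation complex :: real_or_complex
begin
definition scalar_cnj_complex :: "complex \<Rightarrow> complex" where "scalar_cnj_complex = cnj"
instance by standard (simp_all add: scalar_cnj_complex_def scaleR_conv_of_real flip: complex_norm_square)
end

text \<open>
  Completeness and compatibility of the topology with the norm come from the class \<open>banach\<close>;
  the axiom \<open>inner_self\<close> gives positive definiteness and says that the norm is the one induced
  by the inner product.
\<close>

locale hilbert_space = vector_space scl
  for scl :: "'k::real_or_complex \<Rightarrow> 'a::banach \<Rightarrow> 'a" +
  fixes ip :: "'a \<Rightarrow> 'a \<Rightarrow> 'k"
  assumes scale_of_real: "scl (of_real r) x = r *\<^sub>R x"
    and inner_add_left: "ip (x + y) z = ip x z + ip y z"
    and inner_scale_left: "ip (scl c x) y = c * ip x y"
    and inner_commute: "ip y x = scalar_cnj (ip x y)"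
    and inner_self: "ip x x = of_real ((norm x)\<^sup>2)"

lemma hilbert_space_real:
  "hilbert_space (scaleR :: real \<Rightarrow> 'a \<Rightarrow> 'a::{real_inner,banach}) inner"
  by unfold_locales
    (simp_all add: algebra_simps inner_commute scalar_cnj_real_def power2_norm_eq_inner)

lemma hilbert_space_complex: "hilbert_space ((*) :: complex \<Rightarrow> _) (\<lambda>x y. x * cnj y)"
  by unfold_locales
    (simp_all add: algebra_simps scalar_cnj_complex_def scaleR_conv_of_real
      flip: complex_norm_square)

definition bounded_operator ::
  "('k::real_or_complex \<Rightarrow> 'a::banach \<Rightarrow> 'a) \<Rightarrow> ('a \<Rightarrow> 'a) \<Rightarrow> bool" where
  "bounded_operator scl B \<longleftrightarrow>
     bounded_linear B \<and> (\<forall>c x. B (scl c x) = scl c (B x))"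

definition positive_semidefinite ::
  "('a::banach \<Rightarrow> 'a \<Rightarrow> 'k::real_or_complex) \<Rightarrow> ('a \<Rightarrow> 'a) \<Rightarrow> bool" where
  "positive_semidefinite ip B \<longleftrightarrow>
     (\<forall>f g. ip (B f) g = ip f (B g)) \<and> (\<forall>f. \<exists>r\<ge>0. ip (B f) f = of_real r)"

definition positive_sqrt ::
  "('k::real_or_complex \<Rightarrow> 'a::banach \<Rightarrow> 'a) \<Rightarrow> ('a \<Rightarrow> 'a \<Rightarrow> 'k) \<Rightarrow> ('a \<Rightarrow> 'a) \<Rightarrow> 'a \<Rightarrow> 'a" where
  "positive_sqrt scl ip B =
     (THE S. bounded_operator scl S \<and> positive_semidefinite ip S \<and> S \<circ> S = B)"

text \<open>
  Families are indexed by \<open>I = \<nat>\<close> or \<open>I = \<int>\<close>, both as sets of integers (so \<open>\<int> = UNIV\<close>).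
  The partial sum below is then the sum over \<open>0, \<dots>, M\<close> for \<open>I = \<nat>\<close> and over \<open>-M, \<dots>, M\<close> for
  \<open>I = \<int>\<close>; values of the family outside \<open>I\<close> are irrelevant.
\<close>

definition converges_along :: "int set \<Rightarrow> (int \<Rightarrow> 'a::real_normed_vector) \<Rightarrow> 'a \<Rightarrow> bool" where
  "converges_along I g s \<longleftrightarrow>
     (\<lambda>M::nat. \<Sum>n\<in>{n \<in> I. \<bar>n\<bar> \<le> int M}. g n) \<longlonglongrightarrow> s"

lemma partial_sum_index_Nats: "{n \<in> (\<nat>::int set). \<bar>n\<bar> \<le> int M} = int ` {0..M}"
  by (auto simp: Nats_def)

lemma partial_sum_index_Ints: "{n \<in> (\<int>::int set). \<bar>n\<bar> \<le> int M} = {- int M..int M}"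
  by (auto simp: Ints_def)

definition frame_reconstruction ::
  "('k::real_or_complex \<Rightarrow> 'a::banach \<Rightarrow> 'a) \<Rightarrow> ('a \<Rightarrow> 'a \<Rightarrow> 'k) \<Rightarrow> int set \<Rightarrow>
     (int \<Rightarrow> 'a) \<Rightarrow> ('a \<Rightarrow> 'a) \<Rightarrow> bool" where
  "frame_reconstruction scl ip I f B \<longleftrightarrow>
     (\<forall>h. converges_along I (\<lambda>n. scl (ip h (B (f n))) (f n)) h)"

definition parseval_frame ::
  "('a::banach \<Rightarrow> 'a \<Rightarrow> 'k::real_or_complex) \<Rightarrow> int set \<Rightarrow> (int \<Rightarrow> 'a) \<Rightarrow> bool" where
  "parseval_frame ip I g \<longleftrightarrow>
     (\<forall>h. ((\<lambda>n. (norm (ip h (g n)))\<^sup>2) has_sum (norm h)\<^sup>2) I)"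

end

theory Submission imports Defs begin

text \<open>
  Applying \<open>B\<close> to the reconstruction formula gives \<open>B h = lim \<Sum> \<langle>h, B f\<^sub>n\<rangle> B f\<^sub>n\<close>, whose coefficients
  are symmetric: hence \<open>B\<close> is self-adjoint and \<open>\<langle>B h, h\<rangle> = \<Sum> \<bar>\<langle>h, B f\<^sub>n\<rangle>\<bar>\<^sup>2\<close>. Injectivity is read off
  from the formula, and an injective positive operator has dense range, because the powers of the
  contraction \<open>1 - B / b\<close> tend strongly to \<open>0\<close>. The first sum in (2) is the adjoint of the
  reconstruction sum; it converges on the range of \<open>B\<close>, hence everywhere by uniform boundedness.
  For (5), \<open>\<Sum> \<bar>\<langle>S g, S f\<^sub>n\<rangle>\<bar>\<^sup>2 = \<langle>B g, g\<rangle> = \<parallel>S g\<parallel>\<^sup>2\<close> with \<open>S = \<surd>B\<close>, and \<open>S\<close> has dense range.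
\<close>

section \<open>Scalars\<close>

lemma scalar_cnj_0 [simp]: "scalar_cnj 0 = (0::'k::real_or_complex)"
  using scalar_cnj_add[of "0::'k" 0] by simp

text \<open>Dividing in \<open>mult_scalar_cnj\<close> determines the conjugate of a nonzero scalar;
  the laws below then reduce to field arithmetic, with 0 treated separately.\<close>

lemma scalar_cnj_eq: "z \<noteq> 0 \<Longrightarrow> scalar_cnj z = of_real ((norm z)\<^sup>2) / (z::'k::real_or_complex)"
  using mult_scalar_cnj[of z] by (simp add: field_simps scaleR_conv_of_real)

lemma scalar_cnj_mult: "scalar_cnj (x * y) = scalar_cnj x * scalar_cnj (y::'k::real_or_complex)"
  by (cases "x = 0 \<or> y = 0") (auto simp: scalar_cnj_eq norm_mult power_mult_distrib)

lemma scalar_cnj_of_real [simp]: "scalar_cnj (of_real r) = (of_real r :: 'k::real_or_complex)"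
  by (cases "r = 0") (simp_all add: scalar_cnj_eq power2_eq_square)

lemma norm_scalar_cnj [simp]: "norm (scalar_cnj z) = norm (z::'k::real_or_complex)"
  by (cases "z = 0") (simp_all add: scalar_cnj_eq norm_divide norm_mult power2_eq_square)

lemma scalar_cnj_cnj [simp]: "scalar_cnj (scalar_cnj z) = (z::'k::real_or_complex)"
  by (cases "z = 0") (simp_all add: scalar_cnj_eq norm_divide norm_mult power2_eq_square)

lemma scalar_cnj_diff: "scalar_cnj (x - y) = scalar_cnj x - scalar_cnj (y::'k::real_or_complex)"
  by (metis scalar_cnj_add add_diff_cancel diff_add_cancel)

lemma scalar_cnj_sum: "scalar_cnj (\<Sum>i\<in>A. g i) = (\<Sum>i\<in>A. scalar_cnj (g i :: 'k::real_or_complex))"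
  by (induction A rule: infinite_finite_induct) (simp_all add: scalar_cnj_add)

text \<open>Conjugation is an additive isometry, so distances to the limit are unchanged.\<close>

lemma tendsto_scalar_cnj:
  assumes "(g \<longlongrightarrow> (l::'k::real_or_complex)) F"
  shows "((\<lambda>x. scalar_cnj (g x)) \<longlongrightarrow> scalar_cnj l) F"
  using assms by (simp add: tendsto_iff dist_norm flip: scalar_cnj_diff)

text \<open>The real part by polarization, from |1 + z|^2 = 1 + 2 Re z + |z|^2. Half of
  \<open>z + scalar_cnj z\<close> would be a scalar of type \<open>'k\<close> and not a real
  number.\<close>

definition scalar_re :: "'k::real_or_complex \<Rightarrow> real" where
  "scalar_re z = ((norm (1 + z))\<^sup>2 - 1 - (norm z)\<^sup>2) / 2"

lemma add_scalar_cnj: "z + scalar_cnj z = of_real (2 * scalar_re (z::'k::real_or_complex))"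
proof -
  have "of_real ((norm (1 + z))\<^sup>2) = (1 + z) * scalar_cnj (1 + z)"
    by (simp add: mult_scalar_cnj scaleR_conv_of_real)
  also have "\<dots> = 1 + z + scalar_cnj z + z * scalar_cnj z"
    using scalar_cnj_of_real[of 1, where ?'k = 'k]
    by (simp add: scalar_cnj_add algebra_simps del: scalar_cnj_of_real)
  also have "z * scalar_cnj z = of_real ((norm z)\<^sup>2)"
    by (simp add: mult_scalar_cnj scaleR_conv_of_real)
  finally show ?thesis
    by (simp add: scalar_re_def algebra_simps)
qed

lemma scalar_re_eqI: "z + scalar_cnj z = of_real (2 * r) \<Longrightarrow> scalar_re (z::'k::real_or_complex) = r"
  unfolding add_scalar_cnj by (simp only: of_real_eq_iff)

lemma scalar_re_add: "scalar_re (x + y) = scalar_re x + scalar_re (y::'k::real_or_complex)"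
  by (rule scalar_re_eqI)
    (use add_scalar_cnj[of x] add_scalar_cnj[of y] in \<open>simp add: scalar_cnj_add algebra_simps\<close>)

lemma scalar_re_of_real_mult: "scalar_re (of_real r * z) = r * scalar_re (z::'k::real_or_complex)"
  by (rule scalar_re_eqI) (simp add: scalar_cnj_mult add_scalar_cnj flip: distrib_left)

lemma scalar_re_of_real [simp]: "scalar_re (of_real r :: 'k::real_or_complex) = r"
  by (rule scalar_re_eqI) simp

lemma scalar_re_cnj [simp]: "scalar_re (scalar_cnj z) = scalar_re (z::'k::real_or_complex)"
  by (rule scalar_re_eqI) (use add_scalar_cnj[of z] in \<open>simp add: add.commute\<close>)

lemma abs_scalar_re_le: "\<bar>scalar_re z\<bar> \<le> norm (z::'k::real_or_complex)"
proof -
  have "norm (of_real (2 * scalar_re z) :: 'k) \<le> norm z + norm (scalar_cnj z)"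
    unfolding add_scalar_cnj[symmetric] by (rule norm_triangle_ineq)
  then show ?thesis
    by (simp del: of_real_mult)
qed

lemma bounded_linear_scalar_re: "bounded_linear (scalar_re :: 'k::real_or_complex \<Rightarrow> real)"
  by (rule bounded_linear_intro[where K = 1])
    (use abs_scalar_re_le in \<open>simp_all add: scalar_re_add scalar_re_of_real_mult scaleR_conv_of_real\<close>)

lemma scalar_cnj_eq_self_imp: "scalar_cnj z = z \<Longrightarrow> z = of_real (scalar_re (z::'k::real_or_complex))"
  using add_scalar_cnj[of z] by simp

section \<open>Uniform boundedness\<close>

text \<open>Banach-Steinhaus by Baire category: convergent sequences are bounded, so the closed sets
  \<open>K m\<close> cover the space and one of them contains a ball.\<close>

lemma uniformly_bounded_if_convergent:
  fixes S :: "nat \<Rightarrow> 'a::banach \<Rightarrow> 'b::real_normed_vector"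
  assumes lin: "\<And>n. bounded_linear (S n)"
    and conv: "\<And>x. convergent (\<lambda>n. S n x)"
  obtains C where "C > 0" "\<And>n x. norm (S n x) \<le> C * norm x"
proof -
  define K where "K m = {x. \<forall>n. norm (S n x) \<le> real m}" for m :: nat
  have "closed (K m)" for m
  proof -
    have "K m = (\<Inter>n. {x. norm (S n x) \<le> real m})"
      by (auto simp: K_def)
    moreover have "closed {x. norm (S n x) \<le> real m}" for n
      by (intro closed_Collect_le continuous_intros linear_continuous_on lin)
    ultimately show ?thesis
      by auto
  qed
  moreover have "\<Union>(range K) = UNIV"
  proof -
    have "x \<in> \<Union>(range K)" for x
    proof -
      obtain b where b: "\<And>n. norm (S n x) \<le> b"
        using convergent_imp_Bseq[OF conv[of x]] by (auto simp: Bseq_def)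
      obtain m where m: "b \<le> real m"
        using real_arch_simple by blast
      have "x \<in> K m"
        using order_trans[OF b m] by (simp add: K_def)
      then show ?thesis by blast
    qed
    then show ?thesis by auto
  qed
  ultimately have "\<exists>m. interior (K m) \<noteq> {}"
    using Baire_category_alt[OF disjI1[OF completely_metrizable_space_euclidean], of "range K"]
    by force
  then obtain m where "interior (K m) \<noteq> {}" ..
  then obtain x0 r where r: "r > 0" "cball x0 r \<subseteq> K m"
    by (metis equals0I interior_subset mem_interior_cball)
  have bd: "norm (S n x) \<le> (2 * real m / r) * norm x" for n x
  proof (cases "x = 0")
    case True
    then show ?thesis
      using linear_0[OF bounded_linear.linear[OF lin]] by simp
  next
    case False
    interpret bounded_linear "S n" by (rule lin)
    \<comment> \<open>Rescaling to norm \<open>r\<close> puts \<open>x0 + y\<close> in the ball. The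
      values at \<open>x0 + y\<close> and \<open>x0\<close> have norm at most \<open>m\<close>, so
      their difference \<open>S n y\<close> has norm at most \<open>2 * m\<close>.\<close>
    define y where "y = (r / norm x) *\<^sub>R x"
    have "x0 + y \<in> K m" "x0 \<in> K m"
      using r False by (auto simp: y_def dist_norm subset_iff)
    then have "norm (S n (x0 + y)) \<le> m" "norm (S n x0) \<le> m"
      by (auto simp: K_def)
    then have "norm (S n y) \<le> 2 * m"
      using norm_triangle_ineq4[of "S n (x0 + y)" "S n x0"] by (simp add: add)
    then show ?thesis
      using r False by (simp add: y_def scaleR field_simps)
  qed
  \<comment> \<open>Adding 1 keeps the constant positive even when \<open>m\<close> is 0.\<close>
  have "norm (S n x) \<le> (2 * real m / r + 1) * norm x" for n x
    using bd[of n x] by (simp add: distrib_right add_increasing2)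
  moreover have "2 * real m / r + 1 > 0"
    using r by (simp add: add_nonneg_pos)
  ultimately show ?thesis using that by blast
qed

section \<open>Positive operators\<close>

context hilbert_space
begin

section \<open>Algebra of the inner product and its real part\<close>

lemma inner_0_left [simp]: "ip 0 y = 0"
  using inner_add_left[of 0 0 y] by simp

lemma inner_diff_left: "ip (x - y) z = ip x z - ip y z"
  by (metis inner_add_left add_diff_cancel diff_add_cancel)

lemma inner_scaleR_left: "ip (r *\<^sub>R x) y = r *\<^sub>R ip x y"
  by (metis inner_scale_left scale_of_real scaleR_conv_of_real)

lemma inner_add_right: "ip x (y + z) = ip x y + ip x z"
  by (metis inner_add_left inner_commute scalar_cnj_add)

lemma inner_diff_right: "ip x (y - z) = ip x y - ip x z"
  by (metis inner_diff_left inner_commute scalar_cnj_diff)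

lemma inner_0_right [simp]: "ip x 0 = 0"
  using inner_add_right[of x 0 0] by simp

lemma inner_scale_right: "ip x (scl c y) = scalar_cnj c * ip x y"
  by (metis inner_scale_left inner_commute scalar_cnj_mult)

lemma inner_scaleR_right: "ip x (r *\<^sub>R y) = r *\<^sub>R ip x y"
  by (metis inner_scale_right scalar_cnj_of_real scale_of_real scaleR_conv_of_real)

lemma inner_sum_left: "ip (\<Sum>i\<in>A. g i) y = (\<Sum>i\<in>A. ip (g i) y)"
  by (induction A rule: infinite_finite_induct) (simp_all add: inner_add_left)

lemma norm_inner_commute: "norm (ip x y) = norm (ip y x)"
  by (metis inner_commute norm_scalar_cnj)

lemma norm_scale: "norm (scl c x) = norm c * norm x"
proof -
  have "of_real ((norm (scl c x))\<^sup>2) = c * scalar_cnj c * ip x x"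
    unfolding inner_self[symmetric] by (simp add: inner_scale_left inner_scale_right mult.assoc)
  also have "\<dots> = of_real ((norm c * norm x)\<^sup>2)"
    by (simp add: mult_scalar_cnj inner_self power_mult_distrib scaleR_conv_of_real)
  finally show ?thesis
    by (simp only: of_real_eq_iff) simp
qed

text \<open>A real inner product with the same norm. The abstract scalars carry no order, so
  inequalities are expressed through it.\<close>

definition re_inner :: "'a \<Rightarrow> 'a \<Rightarrow> real" where
  "re_inner x y = scalar_re (ip x y)"

lemma re_inner_self: "re_inner x x = (norm x)\<^sup>2"
  by (simp add: re_inner_def inner_self del: of_real_power)

lemma re_inner_commute: "re_inner x y = re_inner y x"
  by (metis re_inner_def inner_commute scalar_re_cnj)

lemma re_inner_add_left: "re_inner (x + y) z = re_inner x z + re_inner y z"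
  by (simp add: re_inner_def inner_add_left scalar_re_add)

lemma re_inner_scaleR_left: "re_inner (r *\<^sub>R x) y = r * re_inner x y"
  by (simp add: re_inner_def inner_scaleR_left scaleR_conv_of_real scalar_re_of_real_mult)

lemma re_inner_diff_left: "re_inner (x - y) z = re_inner x z - re_inner y z"
  by (metis re_inner_add_left add_diff_cancel diff_add_cancel)

lemma re_inner_add_right: "re_inner x (y + z) = re_inner x y + re_inner x z"
  by (metis re_inner_add_left re_inner_commute)

lemma re_inner_diff_right: "re_inner x (y - z) = re_inner x y - re_inner x z"
  by (metis re_inner_diff_left re_inner_commute)

lemma re_inner_scaleR_right: "re_inner x (r *\<^sub>R y) = r * re_inner x y"
  by (metis re_inner_scaleR_left re_inner_commute)

lemmas re_inner_algebra = re_inner_add_left re_inner_add_right re_inner_diff_left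
  re_inner_diff_right re_inner_scaleR_left re_inner_scaleR_right

lemma norm_diff_sq: "(norm (x - y))\<^sup>2 = (norm x)\<^sup>2 - 2 * re_inner x y + (norm y)\<^sup>2"
  unfolding re_inner_self[symmetric]
  by (simp add: re_inner_algebra re_inner_commute[of y x])

lemma norm_inner_le: "norm (ip x y) \<le> norm x * norm y"
proof (cases "y = 0")
  case False
  \<comment> \<open>\<open>scl c y\<close> is the orthogonal projection of \<open>x\<close> onto the
    line through \<open>y\<close>; Cauchy-Schwarz says that the squared distance of \<open>x\<close>
    to it is nonnegative.\<close>
  define c where "c = ip x y * of_real (1 / (norm y)\<^sup>2)"
  have nc: "norm c = norm (ip x y) / (norm y)\<^sup>2"
    unfolding c_def norm_mult norm_of_real by simp
  have cy: "ip x (scl c y) = of_real ((norm (ip x y))\<^sup>2 / (norm y)\<^sup>2)"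
    using mult_scalar_cnj[of "ip x y"]
    unfolding c_def inner_scale_right scalar_cnj_mult scalar_cnj_of_real
    by (simp add: scaleR_conv_of_real mult_ac)
  have "0 \<le> (norm (x - scl c y))\<^sup>2"
    by simp
  also have "\<dots> = (norm x)\<^sup>2 - (norm (ip x y))\<^sup>2 / (norm y)\<^sup>2"
    unfolding norm_diff_sq re_inner_def cy scalar_re_of_real norm_scale nc
    using False by (simp add: field_simps power2_eq_square)
  finally have "(norm (ip x y))\<^sup>2 \<le> (norm x * norm y)\<^sup>2"
    using False by (simp add: field_simps)
  then show ?thesis
    by (rule power2_le_imp_le) simp
qed simp

lemma bounded_linear_inner_left: "bounded_linear (\<lambda>x. ip x y)"
  by (rule bounded_linear_intro[where K = "norm y"])
    (simp_all add: inner_add_left inner_scaleR_left norm_inner_le)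

lemma bounded_linear_inner_right: "bounded_linear (\<lambda>y. ip x y)"
  by (rule bounded_linear_intro[where K = "norm x"])
    (simp_all add: inner_add_right inner_scaleR_right norm_inner_le mult.commute[of _ "norm x"])

lemma bounded_linear_re_inner_left: "bounded_linear (\<lambda>x. re_inner x y)"
  unfolding re_inner_def
  by (rule bounded_linear_compose[OF bounded_linear_scalar_re bounded_linear_inner_left])

lemma re_inner_le: "re_inner x y \<le> norm x * norm y"
  using abs_scalar_re_le[of "ip x y"] norm_inner_le[of x y] by (simp add: re_inner_def)

text \<open>Symmetry makes \<open>ip (S f) f\<close> its own conjugate, hence a real scalar, so only
  the sign of its real part remains to be checked.\<close>

lemma positive_semidefinite_iff:
  "positive_semidefinite ip S \<longleftrightarrow>
     (\<forall>f g. ip (S f) g = ip f (S g)) \<and> (\<forall>f. re_inner (S f) f \<ge> 0)"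
proof safe
  fix f assume "positive_semidefinite ip S"
  then obtain r where "r \<ge> 0" "ip (S f) f = of_real r"
    unfolding positive_semidefinite_def by blast
  then show "re_inner (S f) f \<ge> 0"
    by (simp add: re_inner_def)
next
  assume sym: "\<forall>f g. ip (S f) g = ip f (S g)" and pos: "\<forall>f. re_inner (S f) f \<ge> 0"
  have "ip (S f) f = of_real (re_inner (S f) f)" for f
    unfolding re_inner_def using sym inner_commute scalar_cnj_eq_self_imp by metis
  with sym pos show "positive_semidefinite ip S"
    unfolding positive_semidefinite_def by blast
qed (simp_all add: positive_semidefinite_def)

lemma re_inner_psd_commute:
  "positive_semidefinite ip S \<Longrightarrow> re_inner (S x) y = re_inner x (S y)"
  by (simp add: positive_semidefinite_iff re_inner_def)

text \<open>The Cauchy--Schwarz inequality for the form of \<open>S\<close>, read off from its value at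
  \<open>x - (1 / b) S x\<close>.\<close>

lemma psd_norm_sq_le:
  assumes S: "positive_semidefinite ip S" and lin: "linear S"
    and b: "b > 0" "\<And>x. norm (S x) \<le> b * norm x"
  shows "(norm (S x))\<^sup>2 \<le> b * re_inner (S x) x"
proof -
  interpret linear S by (rule lin)
  define s where "s = 1 / b"
  have "0 \<le> re_inner (S (x - s *\<^sub>R S x)) (x - s *\<^sub>R S x)"
    using S by (simp add: positive_semidefinite_iff)
  also have "\<dots> = re_inner (S x) x - 2 * s * (norm (S x))\<^sup>2 + s\<^sup>2 * re_inner (S (S x)) (S x)"
    using re_inner_psd_commute[OF S, of "S x" x]
    by (simp add: diff scale re_inner_algebra re_inner_self power2_eq_square algebra_simps)
  also have "re_inner (S (S x)) (S x) \<le> b * norm (S x) * norm (S x)"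
    by (rule order_trans[OF re_inner_le mult_right_mono[OF b(2)]]) simp
  finally show ?thesis
    using b(1) by (simp add: s_def power2_eq_square field_simps mult_left_mono)
qed

text \<open>By \<open>psd_norm_sq_le\<close> a positive form vanishes only on the kernel. This
  serves both the uniqueness of roots and the density of the range.\<close>

lemma psd_eq_0:
  assumes S: "positive_semidefinite ip S" and lin: "bounded_linear S" and 0: "re_inner (S x) x \<le> 0"
  shows "S x = 0"
proof -
  obtain b where "b > 0" "\<And>x. norm (S x) \<le> norm x * b"
    using bounded_linear.pos_bounded[OF lin] by blast
  then have "(norm (S x))\<^sup>2 \<le> b * re_inner (S x) x"
    by (intro psd_norm_sq_le[OF S bounded_linear.linear[OF lin]]) (simp_all add: mult.commute)
  also have "\<dots> \<le> 0"
    using 0 \<open>b > 0\<close> by (simp add: mult_le_0_iff)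
  finally show ?thesis by simp
qed

text \<open>The cross term counts the form twice and the quadratic term gives back at most one copy.
  The remaining deficit is what later forces vectors of preserved norm into the kernel of
  \<open>S\<close>.\<close>

lemma norm_psd_contraction:
  assumes S: "positive_semidefinite ip S" and lin: "linear S"
    and b: "b > 0" "\<And>x. norm (S x) \<le> b * norm x"
  shows "(norm (x - (1 / b) *\<^sub>R S x))\<^sup>2 \<le> (norm x)\<^sup>2 - (1 / b) * re_inner (S x) x"
proof -
  have "(norm (x - (1 / b) *\<^sub>R S x))\<^sup>2 =
      (norm x)\<^sup>2 - 2 * (1 / b) * re_inner (S x) x + (1 / b)\<^sup>2 * (norm (S x))\<^sup>2"
    unfolding norm_diff_sq
    by (simp add: re_inner_scaleR_right re_inner_commute[of x] power_divide)
  moreover have "(1 / b)\<^sup>2 * (norm (S x))\<^sup>2 \<le> (1 / b) * re_inner (S x) x"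
    using psd_norm_sq_le[OF assms, of x] b(1) by (simp add: field_simps power2_eq_square)
  ultimately show ?thesis by simp
qed

end

section \<open>Square roots\<close>

text \<open>The Taylor coefficients of \<open>\<surd>(1 - x)\<close>.\<close>

definition sqrt_coeff :: "nat \<Rightarrow> real" where
  "sqrt_coeff n = pochhammer (- 1 / 2) n / fact n"

lemma sqrt_coeff_0 [simp]: "sqrt_coeff 0 = 1"
  by (simp add: sqrt_coeff_def)

text \<open>The first factor of the Pochhammer symbol is -1/2 and the remaining ones are
  positive.\<close>

lemma sqrt_coeff_Suc_le: "sqrt_coeff (Suc n) \<le> 0"
  using pochhammer_nonneg[of "1 / 2 :: real" n]
  by (simp add: sqrt_coeff_def pochhammer_rec divide_le_0_iff)

text \<open>Partial sums are the coefficients of sqrt(1 - x) / (1 - x) = (1 - x)^(-1/2), and are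
  therefore nonnegative.\<close>

lemma sum_sqrt_coeff: "(\<Sum>k\<le>m. sqrt_coeff k) = pochhammer (1 / 2) m / fact m"
proof (induction m)
  case (Suc m)
  have "sqrt_coeff (Suc m) = - (1 / 2) * pochhammer (1 / 2) m / fact (Suc m)"
    by (simp add: sqrt_coeff_def pochhammer_rec)
  then show ?case
    by (simp add: Suc pochhammer_Suc divide_simps) (simp add: algebra_simps)
qed simp

text \<open>Only the constant term 1 is positive, so the absolute partial sum is 2 minus the signed
  one, hence at most 2.\<close>

lemma summable_abs_sqrt_coeff: "summable (\<lambda>n. \<bar>sqrt_coeff n\<bar>)"
proof (rule summableI_nonneg_bounded)
  fix n
  have "(\<Sum>k\<le>m. \<bar>sqrt_coeff k\<bar>) = 2 - (\<Sum>k\<le>m. sqrt_coeff k)" for m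
    by (induction m) (simp_all add: abs_of_nonpos[OF sqrt_coeff_Suc_le])
  also have "\<dots> m \<le> 2" for m
    by (simp add: sum_sqrt_coeff pochhammer_nonneg)
  finally have "(\<Sum>k\<le>m. \<bar>sqrt_coeff k\<bar>) \<le> 2" for m .
  moreover have "(\<Sum>k<n. \<bar>sqrt_coeff k\<bar>) \<le> (\<Sum>k\<le>n. \<bar>sqrt_coeff k\<bar>)"
    by (rule sum_mono2) auto
  ultimately show "(\<Sum>k<n. \<bar>sqrt_coeff k\<bar>) \<le> 2"
    using order_trans by blast
qed simp

text \<open>The square of the series is 1 - x: the Vandermonde identity adds the parameters to -1,
  whose Pochhammer symbols vanish from index 2 on.\<close>

lemma sqrt_coeff_convolution:
  "(\<Sum>i\<le>n. sqrt_coeff i * sqrt_coeff (n - i)) = (if n = 0 then 1 else if n = 1 then - 1 else 0)"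
proof -
  have "(\<Sum>i\<le>n. sqrt_coeff i * sqrt_coeff (n - i)) = pochhammer (- 1 / 2 + - 1 / 2) n / fact n"
    unfolding pochhammer_binomial_sum sum_divide_distrib
    by (rule sum.cong) (simp_all add: sqrt_coeff_def binomial_fact field_simps)
  also have "pochhammer (- 1 / 2 + - 1 / 2 :: real) n = (if n = 0 then 1 else if n = 1 then - 1 else 0)"
    by (cases n; cases "n - 1") (simp_all add: pochhammer_rec)
  finally show ?thesis by simp
qed

section \<open>The binomial series of a contraction\<close>

definition sqrt_one_minus :: "('a::banach \<Rightarrow> 'a) \<Rightarrow> 'a \<Rightarrow> 'a" where
  "sqrt_one_minus T x = (\<Sum>n. sqrt_coeff n *\<^sub>R (T ^^ n) x)"

text \<open>Norm exactly 1 is allowed: absolute summability of the coefficients makes the series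
  converge on the boundary of its disc.\<close>

locale linear_contraction = bounded_linear T for T :: "'a::banach \<Rightarrow> 'a" +
  assumes contraction: "norm (T x) \<le> norm x"
begin

lemma contraction_funpow: "norm ((T ^^ n) x) \<le> norm x"
  by (induction n) (auto intro: order_trans[OF contraction])

lemma bounded_linear_funpow: "bounded_linear (T ^^ n)"
proof (induction n)
  case 0
  then show ?case by (simp add: bounded_linear_ident id_def)
next
  case (Suc n)
  then show ?case
    using bounded_linear_compose[OF bounded_linear_axioms Suc] by (simp add: o_def)
qed

lemma summable_norm_sqrt_one_minus: "summable (\<lambda>n. norm (sqrt_coeff n *\<^sub>R (T ^^ n) x))"
  by (rule summable_comparison_test_ev[OF _ summable_mult2[OF summable_abs_sqrt_coeff, of "norm x"]])
    (simp add: mult_left_mono contraction_funpow)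

lemma sums_sqrt_one_minus: "(\<lambda>n. sqrt_coeff n *\<^sub>R (T ^^ n) x) sums sqrt_one_minus T x"
  unfolding sqrt_one_minus_def
  by (rule summable_sums[OF summable_norm_cancel[OF summable_norm_sqrt_one_minus]])

lemma has_sum_sqrt_one_minus:
  "((\<lambda>n. sqrt_coeff n *\<^sub>R (T ^^ n) x) has_sum sqrt_one_minus T x) UNIV"
  by (rule norm_summable_imp_has_sum[OF summable_norm_sqrt_one_minus sums_sqrt_one_minus])

lemma bounded_linear_sqrt_one_minus: "bounded_linear (sqrt_one_minus T)"
proof (rule bounded_linear_intro)
  fix x y :: 'a and r :: real
  interpret p: bounded_linear "T ^^ n" for n by (rule bounded_linear_funpow)
  show "sqrt_one_minus T (x + y) = sqrt_one_minus T x + sqrt_one_minus T y"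
    using sums_add[OF sums_sqrt_one_minus[of x] sums_sqrt_one_minus[of y]]
      sums_sqrt_one_minus[of "x + y"]
    by (simp add: p.add scaleR_add_right sums_unique2)
  show "sqrt_one_minus T (r *\<^sub>R x) = r *\<^sub>R sqrt_one_minus T x"
    using sums_scaleR_right[OF sums_sqrt_one_minus[of x], of r] sums_sqrt_one_minus[of "r *\<^sub>R x"]
    by (simp add: p.scaleR mult.commute[of r] sums_unique2)
  have "norm (sqrt_one_minus T x) \<le> (\<Sum>n. norm (sqrt_coeff n *\<^sub>R (T ^^ n) x))"
    unfolding sqrt_one_minus_def by (rule summable_norm[OF summable_norm_sqrt_one_minus])
  also have "\<dots> \<le> (\<Sum>n. \<bar>sqrt_coeff n\<bar> * norm x)"
    by (rule suminf_le[OF _ summable_norm_sqrt_one_minus summable_mult2[OF summable_abs_sqrt_coeff]])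
      (simp add: mult_left_mono contraction_funpow)
  also have "\<dots> = norm x * (\<Sum>n. \<bar>sqrt_coeff n\<bar>)"
    by (simp add: suminf_mult2[OF summable_abs_sqrt_coeff, symmetric])
  finally show "norm (sqrt_one_minus T x) \<le> norm x * (\<Sum>n. \<bar>sqrt_coeff n\<bar>)" .
qed

text \<open>A Cauchy product: the double family is absolutely summable, so it may be summed by rows,
  giving the iterated root, or along the diagonals \<open>i + j = n\<close>, giving the
  convolution.\<close>

lemma sqrt_one_minus_twice: "sqrt_one_minus T (sqrt_one_minus T x) = x - T x"
proof -
  define f where "f = (\<lambda>(i, j). (sqrt_coeff i * sqrt_coeff j) *\<^sub>R (T ^^ (i + j)) x)"
  have abs_sum: "((\<lambda>n. \<bar>sqrt_coeff n\<bar>) has_sum (\<Sum>n. \<bar>sqrt_coeff n\<bar>)) UNIV"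
    by (rule norm_summable_imp_has_sum)
      (simp_all add: summable_abs_sqrt_coeff summable_sums)
  have "(\<lambda>(i, j). \<bar>sqrt_coeff i\<bar> * (\<bar>sqrt_coeff j\<bar> * norm x)) summable_on (UNIV \<times> UNIV)"
  proof (rule summable_on_SigmaI)
    show "((\<lambda>j. (\<lambda>(i, j). \<bar>sqrt_coeff i\<bar> * (\<bar>sqrt_coeff j\<bar> * norm x)) (i, j)) has_sum
        \<bar>sqrt_coeff i\<bar> * ((\<Sum>n. \<bar>sqrt_coeff n\<bar>) * norm x)) UNIV" for i
      by (simp add: has_sum_cmult_right has_sum_cmult_left abs_sum)
    show "(\<lambda>i. \<bar>sqrt_coeff i\<bar> * ((\<Sum>n. \<bar>sqrt_coeff n\<bar>) * norm x)) summable_on UNIV"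
      by (intro summable_on_cmult_left has_sum_imp_summable[OF abs_sum])
  qed simp
  then have "f abs_summable_on (UNIV \<times> UNIV)"
    by (rule Infinite_Sum.abs_summable_on_comparison_test')
      (auto simp: f_def abs_mult mult.assoc intro!: mult_left_mono contraction_funpow)
  then have summable: "f summable_on (UNIV \<times> UNIV)"
    by (rule abs_summable_summable)
  have "((\<lambda>j. f (i, j)) has_sum sqrt_coeff i *\<^sub>R (T ^^ i) (sqrt_one_minus T x)) UNIV" for i
  proof -
    have "bounded_linear (\<lambda>y. sqrt_coeff i *\<^sub>R (T ^^ i) y)"
      by (rule bounded_linear_compose[OF bounded_linear_scaleR_right bounded_linear_funpow])
    from has_sum_bounded_linear[OF this has_sum_sqrt_one_minus[of x]] show ?thesis
      by (simp add: f_def o_def funpow_add linear_cmul[OF bounded_linear.linear[OF bounded_linear_funpow]])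
  qed
  from has_sum_SigmaI[OF this has_sum_sqrt_one_minus summable]
  have "(f has_sum sqrt_one_minus T (sqrt_one_minus T x)) (UNIV \<times> UNIV)" .
  also have "?this \<longleftrightarrow> ((\<lambda>(n, i). (sqrt_coeff i * sqrt_coeff (n - i)) *\<^sub>R (T ^^ n) x)
      has_sum sqrt_one_minus T (sqrt_one_minus T x)) (SIGMA n:UNIV. {..n})"
    by (rule has_sum_reindex_bij_witness[where i = "\<lambda>(n, i). (i, n - i)" and j = "\<lambda>(i, j). (i + j, i)"])
      (auto simp: f_def)
  finally have "((\<lambda>n. \<Sum>i\<le>n. (sqrt_coeff i * sqrt_coeff (n - i)) *\<^sub>R (T ^^ n) x)
      has_sum sqrt_one_minus T (sqrt_one_minus T x)) UNIV"
    by (rule has_sum_SigmaD) (auto intro: has_sum_finite)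
  moreover have "((\<lambda>n. \<Sum>i\<le>n. (sqrt_coeff i * sqrt_coeff (n - i)) *\<^sub>R (T ^^ n) x)
      has_sum (x - T x)) UNIV"
    unfolding scaleR_sum_left[symmetric] sqrt_coeff_convolution
    \<comment> \<open>Only the diagonals 0 and 1 have nonzero coefficients, 1 and -1.\<close>
    by (rule has_sum_finite_neutralI[where B = "{0, 1}"]) auto
  ultimately show ?thesis
    by (rule has_sum_unique)
qed

text \<open>\<open>C\<close> passes through every power and, being continuous, through the
  series.\<close>

lemma sqrt_one_minus_commute:
  assumes C: "bounded_linear C" and comm: "\<And>x. C (T x) = T (C x)"
  shows "C (sqrt_one_minus T x) = sqrt_one_minus T (C x)"
proof -
  have "C ((T ^^ n) x) = (T ^^ n) (C x)" for n
    by (induction n) (simp_all add: comm)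
  then have "(\<lambda>n. sqrt_coeff n *\<^sub>R (T ^^ n) (C x)) sums C (sqrt_one_minus T x)"
    using bounded_linear.sums[OF C sums_sqrt_one_minus[of x]]
    by (simp add: linear_cmul[OF bounded_linear.linear[OF C]])
  then show ?thesis
    using sums_sqrt_one_minus sums_unique2 by blast
qed

end

context hilbert_space
begin

section \<open>Positive square roots of positive operators\<close>

lemma bounded_operatorD: "bounded_operator scl S \<Longrightarrow> bounded_linear S"
  by (simp add: bounded_operator_def)

lemma bounded_linear_scl: "bounded_linear (scl c)"
  by (rule bounded_linear_intro[where K = "norm c"])
    (simp_all add: scale_right_distrib norm_scale mult.commute flip: scale_of_real)

lemma funpow_self_adjoint:
  assumes "\<And>x y. ip (T x) y = ip x (T y)"
  shows "ip ((T ^^ n) x) y = ip x ((T ^^ n) y)"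
  by (induction n arbitrary: x y) (simp_all add: assms funpow_swap1)

text \<open>For positivity, all coefficients after the first are nonpositive and the form of
  \<open>T ^^ n\<close> is at most the squared norm, so replacing it by the squared norm only lowers
  the partial sums. What results is nonnegative by \<open>sum_sqrt_coeff\<close>.\<close>

lemma psd_sqrt_one_minus:
  assumes "linear_contraction T" and sym: "\<And>x y. ip (T x) y = ip x (T y)"
  shows "positive_semidefinite ip (sqrt_one_minus T)"
  unfolding positive_semidefinite_iff
proof safe
  interpret linear_contraction T by fact
  fix x y
  show "ip (sqrt_one_minus T x) y = ip x (sqrt_one_minus T y)"
  proof (rule sums_unique2)
    show "(\<lambda>n. ip (sqrt_coeff n *\<^sub>R (T ^^ n) x) y) sums ip (sqrt_one_minus T x) y"
      by (rule bounded_linear.sums[OF bounded_linear_inner_left sums_sqrt_one_minus])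
    show "(\<lambda>n. ip (sqrt_coeff n *\<^sub>R (T ^^ n) x) y) sums ip x (sqrt_one_minus T y)"
      using bounded_linear.sums[OF bounded_linear_inner_right sums_sqrt_one_minus, of x y]
      by (simp add: inner_scaleR_left inner_scaleR_right funpow_self_adjoint[OF sym])
  qed
next
  interpret linear_contraction T by fact
  fix x
  have "(\<lambda>n. re_inner (sqrt_coeff n *\<^sub>R (T ^^ n) x) x) sums re_inner (sqrt_one_minus T x) x"
    by (rule bounded_linear.sums[OF bounded_linear_re_inner_left sums_sqrt_one_minus])
  then have "(\<lambda>m. \<Sum>n\<le>m. sqrt_coeff n * re_inner ((T ^^ n) x) x) \<longlonglongrightarrow> re_inner (sqrt_one_minus T x) x"
    by (simp add: sums_def_le re_inner_scaleR_left)
  moreover have "0 \<le> (\<Sum>n\<le>m. sqrt_coeff n * re_inner ((T ^^ n) x) x)" for m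
  proof -
    have "0 \<le> (\<Sum>n\<le>m. sqrt_coeff n) * (norm x)\<^sup>2"
      by (simp add: sum_sqrt_coeff pochhammer_nonneg)
    also have "\<dots> \<le> (\<Sum>n\<le>m. sqrt_coeff n * re_inner ((T ^^ n) x) x)"
      unfolding sum_distrib_right
    proof (rule sum_mono)
      fix n
      show "sqrt_coeff n * (norm x)\<^sup>2 \<le> sqrt_coeff n * re_inner ((T ^^ n) x) x"
      proof (cases n)
        case (Suc k)
        have "re_inner ((T ^^ n) x) x \<le> norm x * norm x"
          by (rule order_trans[OF re_inner_le mult_right_mono[OF contraction_funpow]]) simp
        then show ?thesis
          using sqrt_coeff_Suc_le[of k] by (simp add: Suc mult_left_mono_neg power2_eq_square)
      qed (simp add: re_inner_self)
    qed
    finally show ?thesis .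
  qed
  ultimately show "0 \<le> re_inner (sqrt_one_minus T x) x"
    by (blast intro: LIMSEQ_le_const)
qed

lemma psd_contraction:
  assumes S: "positive_semidefinite ip S" and lin: "bounded_linear S"
    and b: "b > 0" "\<And>x. norm (S x) \<le> b * norm x"
  shows "linear_contraction (\<lambda>x. x - (1 / b) *\<^sub>R S x)"
  unfolding linear_contraction_def linear_contraction_axioms_def
proof safe
  fix x
  have "(norm (x - (1 / b) *\<^sub>R S x))\<^sup>2 \<le> (norm x)\<^sup>2 - (1 / b) * re_inner (S x) x"
    by (rule norm_psd_contraction[OF S bounded_linear.linear[OF lin] b])
  also have "\<dots> \<le> (norm x)\<^sup>2"
    using S b(1) by (simp add: positive_semidefinite_iff)
  finally show "norm (x - (1 / b) *\<^sub>R S x) \<le> norm x"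
    by (rule power2_le_imp_le) simp
qed (intro bounded_linear_sub bounded_linear_ident
    bounded_linear_compose[OF bounded_linear_scaleR_right lin])

text \<open>With \<open>T = 1 - B / b\<close> one has \<open>B = b (1 - T)\<close>, so the root is
  \<open>sqrt b\<close> times the binomial series. The commutation property is recorded for the
  uniqueness proof.\<close>

lemma psd_sqrt_exists:
  assumes B: "positive_semidefinite ip B" and op: "bounded_operator scl B"
  obtains S where "bounded_operator scl S" "positive_semidefinite ip S" "S \<circ> S = B"
    "\<And>C x. bounded_linear C \<Longrightarrow> (\<And>y. C (B y) = B (C y)) \<Longrightarrow> C (S x) = S (C x)"
proof -
  have lin: "bounded_linear B" and scl: "\<And>c x. B (scl c x) = scl c (B x)"
    using op by (auto simp: bounded_operator_def)
  obtain b where b: "b > 0" "\<And>x. norm (B x) \<le> b * norm x"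
    using bounded_linear.pos_bounded[OF lin] by (metis mult.commute)
  define T where "T x = x - (1 / b) *\<^sub>R B x" for x
  interpret T: linear_contraction T
    unfolding T_def by (rule psd_contraction[OF B lin b])
  define S where "S x = sqrt b *\<^sub>R sqrt_one_minus T x" for x
  interpret Q: bounded_linear "sqrt_one_minus T"
    by (rule T.bounded_linear_sqrt_one_minus)
  have sym: "ip (T x) y = ip x (T y)" for x y
    using B by (simp add: T_def inner_diff_left inner_diff_right inner_scaleR_left inner_scaleR_right
        positive_semidefinite_def)
  have Q: "positive_semidefinite ip (sqrt_one_minus T)"
    by (rule psd_sqrt_one_minus[OF T.linear_contraction_axioms sym])
  have comm: "C (S x) = S (C x)" if C: "bounded_linear C" and "\<And>y. C (B y) = B (C y)" for C x
  proof -
    interpret C: bounded_linear C by (rule C)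
    have "C (sqrt_one_minus T x) = sqrt_one_minus T (C x)"
      by (rule T.sqrt_one_minus_commute[OF C]) (simp add: T_def C.diff C.scaleR that)
    then show ?thesis
      by (simp add: S_def C.scaleR)
  qed
  show thesis
  proof (rule that)
    have "bounded_linear S"
      unfolding S_def
      by (rule bounded_linear_compose[OF bounded_linear_scaleR_right Q.bounded_linear_axioms])
    \<comment> \<open>Scalar multiplication is itself a real-linear bounded map commuting with
      \<open>B\<close>.\<close>
    moreover have "S (scl c x) = scl c (S x)" for c x
      using comm[OF bounded_linear_scl] scl by simp
    ultimately show "bounded_operator scl S"
      by (simp add: bounded_operator_def)
    show "positive_semidefinite ip S"
      using Q b(1)
      by (simp add: positive_semidefinite_iff S_def inner_scaleR_left inner_scaleR_right re_inner_scaleR_left)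
    show "S \<circ> S = B"
      using b(1) by (simp add: fun_eq_iff S_def Q.scaleR T.sqrt_one_minus_twice T_def)
  qed (rule comm)
qed

text \<open>The definite description yields these properties only once the root is known to be
  unique.\<close>

lemma positive_sqrt:
  assumes B: "positive_semidefinite ip B" and op: "bounded_operator scl B"
  defines "S \<equiv> positive_sqrt scl ip B"
  shows "bounded_operator scl S" "positive_semidefinite ip S" "S \<circ> S = B"
proof -
  let ?P = "\<lambda>S. bounded_operator scl S \<and> positive_semidefinite ip S \<and> S \<circ> S = B"
  obtain R where R: "bounded_operator scl R" "positive_semidefinite ip R" "R \<circ> R = B"
    and comm: "\<And>C x. bounded_linear C \<Longrightarrow> (\<And>y. C (B y) = B (C y)) \<Longrightarrow> C (R x) = R (C x)"
    by (rule psd_sqrt_exists[OF B op]) blast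
  txt \<open>\<open>R\<close> commutes with every other root \<open>R'\<close>, so that \<open>(R + R') (R - R') = B - B = 0\<close>.\<close>
  have "R' = R" if R': "?P R'" for R'
  proof
    fix x
    have RR: "R (R y) = B y" "R' (R' y) = B y" for y
      using R(3) R' by (auto simp: fun_eq_iff)
    have lin: "bounded_linear R" "bounded_linear R'"
      using R(1) R' by (auto dest: bounded_operatorD)
    interpret R: bounded_linear R by fact
    interpret R': bounded_linear R' by fact
    define w where "w = R x - R' x"
    \<comment> \<open>\<open>R'\<close> commutes with its own square, which is
      \<open>B\<close>.\<close>
    have "R' (R y) = R (R' y)" for y
      by (rule comm[OF lin(2)]) (simp flip: RR(2))
    then have "R w + R' w = 0"
      by (simp add: w_def R.diff R'.diff RR)
    then have sum0: "re_inner (R w) w + re_inner (R' w) w = 0"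
      by (metis re_inner_add_left inner_0_left re_inner_def scalar_re_of_real of_real_0)
    have "re_inner (R w) w \<ge> 0" "re_inner (R' w) w \<ge> 0"
      using R(2) R' by (auto simp: positive_semidefinite_iff)
    with sum0 have "R w = 0" "R' w = 0"
      using psd_eq_0 R(2) R' lin by auto
    \<comment> \<open>Both forms vanish at \<open>w\<close>, so \<open>w\<close> lies in both
      kernels; self-adjointness then moves \<open>R\<close> and \<open>R'\<close> onto
      \<open>w\<close>.\<close>
    have "(norm w)\<^sup>2 = re_inner (R x) w - re_inner (R' x) w"
      by (simp add: w_def re_inner_self[symmetric] re_inner_diff_left)
    also have "\<dots> = re_inner x (R w) - re_inner x (R' w)"
      using R(2) R' by (simp add: re_inner_psd_commute)
    also have "\<dots> = 0"
      by (simp add: \<open>R w = 0\<close> \<open>R' w = 0\<close>)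
    finally show "R' x = R x"
      by (simp add: w_def)
  qed
  then have "\<exists>!S. ?P S"
    using R by blast
  from theI'[OF this] show "bounded_operator scl S" "positive_semidefinite ip S" "S \<circ> S = B"
    by (auto simp: S_def positive_sqrt_def)
qed

text \<open>Instead of an orthogonal complement, the argument shows that the even powers of
  \<open>T = 1 - B / b\<close> send \<open>h\<close> to 0, while \<open>h\<close> minus each such
  power stays in the range of \<open>B\<close>.\<close>

lemma closure_range_injective_psd:
  assumes B: "positive_semidefinite ip B" and lin: "bounded_linear B" and inj: "inj B"
  shows "closure (range B) = UNIV"
proof -
  interpret B: bounded_linear B by fact
  obtain b where b: "b > 0" "\<And>x. norm (B x) \<le> b * norm x"
    using bounded_linear.pos_bounded[OF lin] by (metis mult.commute)
  define T where "T x = x - (1 / b) *\<^sub>R B x" for x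
  interpret T: linear_contraction T
    unfolding T_def by (rule psd_contraction[OF B lin b])
  have sym: "ip (T x) y = ip x (T y)" for x y
    using B by (simp add: T_def inner_diff_left inner_diff_right inner_scaleR_left inner_scaleR_right
        positive_semidefinite_def)
  have "h \<in> closure (range B)" for h
  proof -
    define a where "a k = (norm ((T ^^ k) h))\<^sup>2" for k
    \<comment> \<open>Even exponents make the inner product of \<open>u k\<close> and
      \<open>u l\<close> a squared norm, \<open>a (k + l)\<close>, because \<open>T\<close> is
      self-adjoint.\<close>
    define u where "u k = (T ^^ (k + k)) h" for k
    have "decseq a"
      unfolding decseq_Suc_iff a_def by (simp add: T.contraction power_mono)
    then obtain L where L: "a \<longlonglongrightarrow> L" "\<And>k. L \<le> a k"
      using decseq_convergent[of a 0] by (metis a_def zero_le_power2)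
    have ip_u: "re_inner (u k) (u l) = a (k + l)" for k l
    proof -
      have "ip (u k) (u l) = ip ((T ^^ (k + l)) h) ((T ^^ (k + l)) h)"
        unfolding u_def funpow_add o_def funpow_self_adjoint[OF sym]
        by (metis add.commute add.left_commute comp_apply funpow_add)
      then show ?thesis
        unfolding re_inner_def a_def re_inner_self[unfolded re_inner_def, symmetric] by simp
    qed
    have "Cauchy u"
    proof (rule CauchyI)
      fix e :: real assume "e > 0"
      then have "\<forall>\<^sub>F k in sequentially. a k < L + e\<^sup>2 / 2"
        by (intro order_tendstoD(2)[OF L(1)]) simp
      then obtain N where N: "\<And>k. k \<ge> N \<Longrightarrow> a k < L + e\<^sup>2 / 2"
        by (auto simp: eventually_sequentially)
      have "norm (u k - u l) < e" if "k \<ge> N" "l \<ge> N" for k l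
      proof -
        have "(norm (u k - u l))\<^sup>2 = a (k + k) - 2 * a (k + l) + a (l + l)"
          by (simp add: norm_diff_sq ip_u) (simp add: u_def a_def)
        \<comment> \<open>The two outer terms are each below \<open>L\<close> plus half of the
          squared \<open>e\<close>, and the middle one is at least \<open>L\<close>.\<close>
        also have "\<dots> < e\<^sup>2"
          using N[of "k + k"] N[of "l + l"] L(2)[of "k + l"] that by linarith
        finally show ?thesis
          using \<open>e > 0\<close> by (simp add: power_less_imp_less_base)
      qed
      then show "\<exists>N. \<forall>k\<ge>N. \<forall>l\<ge>N. norm (u k - u l) < e" by blast
    qed
    then obtain p where p: "u \<longlonglongrightarrow> p"
      using Cauchy_convergent_iff convergent_def by blast
    have "(\<lambda>k. T (T (u k))) \<longlonglongrightarrow> T (T p)"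
      by (intro T.tendsto p)
    moreover have "(\<lambda>k. T (T (u k))) \<longlonglongrightarrow> p"
      using LIMSEQ_Suc[OF p] by (simp add: u_def)
    ultimately have "T (T p) = p"
      by (rule LIMSEQ_unique)
    \<comment> \<open>As \<open>T (T p) = p\<close>, the first \<open>T\<close> cannot shorten
      \<open>p\<close>, so the deficit in \<open>norm_psd_contraction\<close> is at most 0.\<close>
    then have "(norm p)\<^sup>2 \<le> (norm (T p))\<^sup>2"
      by (metis T.contraction norm_ge_zero power_mono)
    also have "\<dots> \<le> (norm p)\<^sup>2 - (1 / b) * re_inner (B p) p"
      unfolding T_def by (rule norm_psd_contraction[OF B B.linear_axioms b])
    finally have "re_inner (B p) p \<le> 0"
      using b(1) by (simp add: divide_le_0_iff)
    from psd_eq_0[OF B lin this] have "B p = B 0"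
      by (simp add: B.zero)
    then have "p = 0"
      by (rule injD[OF inj])
    \<comment> \<open>Telescoping: one more power of \<open>T\<close> changes the difference by
      \<open>(1 / b) B\<close> applied to the previous power.\<close>
    have range: "h - (T ^^ k) h \<in> range B" for k
    proof (induction k)
      case 0
      show ?case using B.zero by (metis diff_self funpow_0 rangeI)
    next
      case (Suc k)
      then obtain g where "h - (T ^^ k) h = B g" by blast
      then have "h - (T ^^ Suc k) h = B (g + (1 / b) *\<^sub>R (T ^^ k) h)"
        by (simp add: T_def B.add B.scaleR algebra_simps)
      then show ?case by blast
    qed
    have "\<forall>k. h - u k \<in> range B"
      unfolding u_def using range by blast
    moreover have "(\<lambda>k. h - u k) \<longlonglongrightarrow> h"
      using tendsto_diff[OF tendsto_const p, of h] by (simp add: \<open>p = 0\<close>)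
    ultimately show ?thesis
      unfolding closure_sequential by (intro exI[of _ "\<lambda>k. h - u k"] conjI)
  qed
  then show ?thesis by blast
qed

end

section \<open>Frame reconstruction\<close>

lemma finite_symmetric_section: "finite {n \<in> I. \<bar>n\<bar> \<le> int M}"
  by (rule finite_subset[of _ "{- int M..int M}"]) auto

lemma filterlim_symmetric_section:
  "filterlim (\<lambda>M. {n \<in> I. \<bar>n\<bar> \<le> int M}) (finite_subsets_at_top I) sequentially"
  unfolding filterlim_finite_subsets_at_top
proof safe
  fix F assume F: "finite F" "F \<subseteq> I"
  \<comment> \<open>Inserting 0 makes the maximum meaningful for empty \<open>F\<close>.\<close>
  define K where "K = nat (Max (insert 0 (abs ` F)))"
  have "F \<subseteq> {n \<in> I. \<bar>n\<bar> \<le> int M}" if "M \<ge> K" for M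
  proof
    fix n assume n: "n \<in> F"
    then have "\<bar>n\<bar> \<le> Max (insert 0 (abs ` F))"
      using F by (intro Max_ge) auto
    also have "\<dots> \<le> int M"
      using that by (simp add: K_def)
    finally show "n \<in> {n \<in> I. \<bar>n\<bar> \<le> int M}"
      using n F by auto
  qed
  then show "\<forall>\<^sub>F M in sequentially. finite {n \<in> I. \<bar>n\<bar> \<le> int M} \<and>
      F \<subseteq> {n \<in> I. \<bar>n\<bar> \<le> int M} \<and> {n \<in> I. \<bar>n\<bar> \<le> int M} \<subseteq> I"
    by (auto simp: eventually_sequentially finite_symmetric_section)
qed

text \<open>Every finite partial sum lies below a symmetric one, hence below \<open>s\<close>; this
  gives unconditional summability, and the symmetric sums identify the value.\<close>

lemma converges_along_nonneg_imp_has_sum: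
  fixes g :: "int \<Rightarrow> real"
  assumes "converges_along I g s" and nonneg: "\<And>n. g n \<ge> 0"
  shows "(g has_sum s) I"
proof -
  let ?J = "\<lambda>M. {n \<in> I. \<bar>n\<bar> \<le> int M}"
  have lim: "(\<lambda>M. sum g (?J M)) \<longlonglongrightarrow> s"
    using assms(1) by (simp add: converges_along_def)
  have "incseq (\<lambda>M. sum g (?J M))"
    by (intro incseq_SucI sum_mono2 finite_symmetric_section nonneg) auto
  then have le: "sum g (?J M) \<le> s" for M
    using lim by (rule incseq_le)
  have "sum g F \<le> s" if F: "finite F" "F \<subseteq> I" for F
  proof -
    have "\<forall>\<^sub>F M in sequentially. finite (?J M) \<and> F \<subseteq> ?J M \<and> ?J M \<subseteq> I"
      using filterlim_symmetric_section[of I, unfolded filterlim_finite_subsets_at_top] F by blast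
    from eventually_happens'[OF sequentially_bot this] obtain M where "F \<subseteq> ?J M"
      by blast
    then have "sum g F \<le> sum g (?J M)"
      by (intro sum_mono2 finite_symmetric_section nonneg)
    then show ?thesis
      using le order_trans by blast
  qed
  then have "g summable_on I"
    by (intro nonneg_bdd_above_summable_on nonneg bdd_aboveI[of _ s]) auto
  then have inf: "(g has_sum infsum g I) I"
    by simp
  then have "(\<lambda>M. sum g (?J M)) \<longlonglongrightarrow> infsum g I"
    unfolding has_sum_def by (rule filterlim_compose[OF _ filterlim_symmetric_section])
  with lim have "s = infsum g I"
    by (rule LIMSEQ_unique)
  with inf show ?thesis by simp
qed

lemma infsum_ennreal_eq_SUP:
  assumes "\<And>n. g n \<ge> (0::real)"
  shows "(\<Sum>\<^sub>\<infinity>n\<in>I. ennreal (g n)) = (SUP F\<in>{F. finite F \<and> F \<subseteq> I}. ennreal (sum g F))"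
  by (subst nonneg_infsum_complete) (simp_all add: assms sum_ennreal)

text \<open>An equicontinuity argument with three errors of size \<open>e / 3\<close>.\<close>

lemma LIMSEQ_dense:
  fixes \<phi> :: "nat \<Rightarrow> 'a::metric_space \<Rightarrow> 'b::metric_space"
  assumes lip: "\<And>n x y. dist (\<phi> n x) (\<phi> n y) \<le> C * dist x y"
    and lip': "\<And>x y. dist (\<psi> x) (\<psi> y) \<le> C * dist x y"
    and dense: "closure D = UNIV"
    and lim: "\<And>x. x \<in> D \<Longrightarrow> (\<lambda>n. \<phi> n x) \<longlonglongrightarrow> \<psi> x"
  shows "(\<lambda>n. \<phi> n x) \<longlonglongrightarrow> \<psi> x"
proof (rule metric_LIMSEQ_I)
  fix e :: real assume "e > 0"
  \<comment> \<open>\<open>\<bar>C\<bar> + 1\<close> is positive whatever \<open>C\<close>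
    is.\<close>
  define d where "d = e / (3 * (\<bar>C\<bar> + 1))"
  have "d > 0"
    using \<open>e > 0\<close> by (simp add: d_def)
  then obtain y where y: "y \<in> D" "dist y x < d"
    using dense closure_approachable[of x D] by auto
  have "C * dist x y \<le> (\<bar>C\<bar> + 1) * d"
    using y by (intro mult_mono) (auto simp: dist_commute)
  also have "\<dots> = e / 3"
    by (simp add: d_def field_simps)
  finally have C: "C * dist x y \<le> e / 3" .
  have "C * dist y x \<le> e / 3"
    using C by (simp add: dist_commute)
  obtain N where N: "\<And>n. n \<ge> N \<Longrightarrow> dist (\<phi> n y) (\<psi> y) < e / 3"
    using metric_LIMSEQ_D[OF lim[OF y(1)], of "e / 3"] \<open>e > 0\<close> by auto
  have "dist (\<phi> n x) (\<psi> x) < e" if "n \<ge> N" for n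
    using dist_triangle[of "\<phi> n x" "\<psi> x" "\<phi> n y"] dist_triangle[of "\<phi> n y" "\<psi> x" "\<psi> y"]
      lip[of n x y] lip'[of y x] N[OF that] C \<open>C * dist y x \<le> e / 3\<close> by linarith
  then show "\<exists>N. \<forall>n\<ge>N. dist (\<phi> n x) (\<psi> x) < e" by blast
qed

section \<open>Consequences of frame reconstruction\<close>

locale reconstructing_frame = hilbert_space scl ip
  for scl :: "'k::real_or_complex \<Rightarrow> 'a::banach \<Rightarrow> 'a" and ip :: "'a \<Rightarrow> 'a \<Rightarrow> 'k" +
  fixes I :: "int set" and f :: "int \<Rightarrow> 'a" and B :: "'a \<Rightarrow> 'a"
  assumes bounded_operator: "bounded_operator scl B"
    and reconstruction: "frame_reconstruction scl ip I f B"
begin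

abbreviation sect :: "nat \<Rightarrow> int set" where
  "sect M \<equiv> {n \<in> I. \<bar>n\<bar> \<le> int M}"

lemma bounded_linear_B: "bounded_linear B"
  using bounded_operator by (rule bounded_operatorD)

lemma linear_B: "linear B"
  using bounded_linear_B by (rule bounded_linear.linear)

lemma B_scale: "B (scl c x) = scl c (B x)"
  using bounded_operator by (simp add: bounded_operator_def)

lemma reconstruction_lim:
  "(\<lambda>M. \<Sum>n\<in>sect M. scl (ip h (B (f n))) (f n)) \<longlonglongrightarrow> h"
  using reconstruction by (simp add: frame_reconstruction_def converges_along_def)

text \<open>The reconstruction formula under the continuous functional \<open>ip (B x) g\<close> of
  \<open>x\<close>.\<close>

lemma form_lim:
  "(\<lambda>M. \<Sum>n\<in>sect M. ip h (B (f n)) * ip (B (f n)) g) \<longlonglongrightarrow> ip (B h) g"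
  using bounded_linear.tendsto[OF bounded_linear_compose[OF bounded_linear_inner_left bounded_linear_B]
      reconstruction_lim]
  by (simp add: linear_sum[OF linear_B] B_scale inner_sum_left inner_scale_left)

lemma quadratic_form_lim:
  "(\<lambda>M. \<Sum>n\<in>sect M. (norm (ip h (B (f n))))\<^sup>2) \<longlonglongrightarrow> re_inner (B h) h"
proof -
  have "ip h x * ip x h = of_real ((norm (ip h x))\<^sup>2)" for x
    using mult_scalar_cnj[of "ip h x"] inner_commute[of x h] by (simp add: scaleR_conv_of_real)
  then have "(\<lambda>M. of_real (\<Sum>n\<in>sect M. (norm (ip h (B (f n))))\<^sup>2)) \<longlonglongrightarrow> ip (B h) h"
    using form_lim[of h h] by (simp del: of_real_power)
  from bounded_linear.tendsto[OF bounded_linear_scalar_re this] show ?thesis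
    by (simp add: re_inner_def del: of_real_sum)
qed

lemma psd: "positive_semidefinite ip B"
  unfolding positive_semidefinite_iff
proof safe
  fix h g
  \<comment> \<open>Conjugating the formula with \<open>h\<close> and \<open>g\<close> exchanged
    reproduces the same partial sums, so the two limits agree.\<close>
  have "(\<lambda>M. scalar_cnj (\<Sum>n\<in>sect M. ip g (B (f n)) * ip (B (f n)) h)) \<longlonglongrightarrow> scalar_cnj (ip (B g) h)"
    by (intro tendsto_scalar_cnj form_lim)
  then have "(\<lambda>M. \<Sum>n\<in>sect M. ip h (B (f n)) * ip (B (f n)) g) \<longlonglongrightarrow> ip h (B g)"
    by (simp add: scalar_cnj_sum scalar_cnj_mult mult.commute flip: inner_commute)
  with form_lim[of h g] show "ip (B h) g = ip h (B g)"
    by (rule LIMSEQ_unique)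
  show "0 \<le> re_inner (B h) h"
    by (rule LIMSEQ_le_const[OF quadratic_form_lim]) (simp add: sum_nonneg)
qed

lemma self_adjoint: "ip (B x) y = ip x (B y)"
  using psd by (simp add: positive_semidefinite_def)

text \<open>If \<open>B\<close> kills a vector, self-adjointness makes all its coefficients 0, and
  it is reconstructed as 0.\<close>

lemma inj_B: "inj B"
proof (rule injI)
  fix x y assume "B x = B y"
  then have "B (x - y) = 0"
    by (simp add: linear_diff[OF linear_B])
  then have "ip (x - y) (B g) = 0" for g
    by (metis self_adjoint inner_0_left)
  then have "(\<lambda>_::nat. 0) \<longlonglongrightarrow> x - y"
    using reconstruction_lim[of "x - y"] by simp
  then show "x = y"
    by (simp add: LIMSEQ_const_iff)
qed

lemma dense_range: "closure (range B) = UNIV"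
  by (rule closure_range_injective_psd[OF psd bounded_linear_B inj_B])

lemma quadratic_form_has_sum:
  "((\<lambda>n. (norm (ip h (B (f n))))\<^sup>2) has_sum re_inner (B h) h) I"
  by (rule converges_along_nonneg_imp_has_sum)
    (simp_all add: converges_along_def quadratic_form_lim)

lemma quadratic_form_le: "re_inner (B h) h \<le> onorm B * (norm h)\<^sup>2"
proof -
  have "re_inner (B h) h \<le> norm (B h) * norm h"
    by (rule re_inner_le)
  also have "\<dots> \<le> onorm B * norm h * norm h"
    by (intro mult_right_mono onorm[OF bounded_linear_B]) simp
  finally show ?thesis
    by (simp add: power2_eq_square mult.assoc)
qed

lemma partial_sum_quadratic_form_le:
  assumes "finite F" "F \<subseteq> I"
  shows "(\<Sum>n\<in>F. (norm (ip h (B (f n))))\<^sup>2) \<le> onorm B * (norm h)\<^sup>2"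
  by (rule order_trans[OF finite_sum_le_has_sum[OF quadratic_form_has_sum assms] quadratic_form_le])
    simp

lemma upper_bound:
  "(\<Sum>\<^sub>\<infinity>n\<in>I. ennreal ((norm (ip h (B (f n))))\<^sup>2)) \<le> ennreal (onorm B * (norm h)\<^sup>2)"
proof (subst infsum_ennreal_eq_SUP)
  show "(SUP F\<in>{F. finite F \<and> F \<subseteq> I}. ennreal (\<Sum>n\<in>F. (norm (ip h (B (f n))))\<^sup>2))
      \<le> ennreal (onorm B * (norm h)\<^sup>2)"
    by (rule SUP_least) (simp add: ennreal_leI partial_sum_quadratic_form_le)
qed simp

text \<open>Cauchy-Schwarz for sums applied to the expansion of \<open>ip h h\<close>: the factor
  with \<open>B (f n)\<close> is at most \<open>onorm B\<close> times the squared norm of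
  \<open>h\<close>, and one squared norm cancels.\<close>

lemma lower_bound:
  "ennreal (1 / onorm B * (norm h)\<^sup>2) \<le> (\<Sum>\<^sub>\<infinity>n\<in>I. ennreal ((norm (ip h (f n)))\<^sup>2))"
    (is "_ \<le> ?X")
\<comment> \<open>If \<open>onorm B\<close> is 0, then \<open>1 / onorm B\<close> is 0 and the bound
  is trivial.\<close>
proof (cases "onorm B = 0 \<or> h = 0 \<or> ?X = top")
  case False
  then obtain c where c: "?X = ennreal c" "c \<ge> 0"
    by (cases ?X) auto
  have B: "onorm B > 0"
    using False onorm_pos_le[OF bounded_linear_B] by simp
  have bound: "(norm (\<Sum>n\<in>sect M. ip h (B (f n)) * ip (f n) h))\<^sup>2 \<le> onorm B * (norm h)\<^sup>2 * c" for M
  proof -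
    have "ennreal (\<Sum>n\<in>sect M. (norm (ip h (f n)))\<^sup>2) \<le> ?X"
      by (subst infsum_ennreal_eq_SUP) (auto intro!: SUP_upper finite_symmetric_section)
    then have le: "(\<Sum>n\<in>sect M. (norm (ip h (f n)))\<^sup>2) \<le> c"
      using c by simp
    have "norm (\<Sum>n\<in>sect M. ip h (B (f n)) * ip (f n) h)
        \<le> (\<Sum>n\<in>sect M. norm (ip h (B (f n))) * norm (ip h (f n)))"
      by (rule order_trans[OF norm_sum]) (simp add: norm_mult norm_inner_commute)
    then have "(norm (\<Sum>n\<in>sect M. ip h (B (f n)) * ip (f n) h))\<^sup>2
        \<le> (\<Sum>n\<in>sect M. norm (ip h (B (f n))) * norm (ip h (f n)))\<^sup>2"
      by (simp add: power_mono)
    also have "\<dots> \<le> (\<Sum>n\<in>sect M. (norm (ip h (B (f n))))\<^sup>2) * (\<Sum>n\<in>sect M. (norm (ip h (f n)))\<^sup>2)"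
      by (rule Cauchy_Schwarz_ineq_sum)
    also have "\<dots> \<le> onorm B * (norm h)\<^sup>2 * c"
      using B by (intro mult_mono partial_sum_quadratic_form_le le)
        (auto simp: finite_symmetric_section sum_nonneg)
    finally show ?thesis .
  qed
  have "(\<lambda>M. \<Sum>n\<in>sect M. ip h (B (f n)) * ip (f n) h) \<longlonglongrightarrow> ip h h"
    using bounded_linear.tendsto[OF bounded_linear_inner_left reconstruction_lim, of h h]
    by (simp add: inner_sum_left inner_scale_left)
  then have "(\<lambda>M. (norm (\<Sum>n\<in>sect M. ip h (B (f n)) * ip (f n) h))\<^sup>2) \<longlonglongrightarrow> (norm (ip h h))\<^sup>2"
    by (intro tendsto_intros)
  then have "(norm (ip h h))\<^sup>2 \<le> onorm B * (norm h)\<^sup>2 * c"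
    by (rule LIMSEQ_le_const2) (use bound in blast)
  then have "(norm h)\<^sup>2 * (norm h)\<^sup>2 \<le> (norm h)\<^sup>2 * (onorm B * c)"
    by (simp add: inner_self norm_mult power2_eq_square mult_ac)
  then have "(norm h)\<^sup>2 \<le> onorm B * c"
    by (rule mult_left_le_imp_le) (use False in simp)
  then have "1 / onorm B * (norm h)\<^sup>2 \<le> c"
    using B by (simp add: field_simps)
  then show ?thesis
    unfolding c by (rule ennreal_leI)
qed auto

lemma adjoint_reconstruction: "converges_along I (\<lambda>n. scl (ip h (f n)) (B (f n))) h"
proof -
  define S where "S M x = (\<Sum>n\<in>sect M. scl (ip x (B (f n))) (f n))" for M x
  \<comment> \<open>\<open>A M\<close> is the adjoint of \<open>S M\<close>, so the uniform bound on
    \<open>S M\<close> transfers to it.\<close>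
  define A where "A M x = (\<Sum>n\<in>sect M. scl (ip x (f n)) (B (f n)))" for M x
  have "bounded_linear (\<lambda>x. scl (ip x y) z)" for y z
    by (rule bounded_linear_intro[where K = "norm y * norm z"])
      (simp_all add: inner_add_left inner_scaleR_left scale_left_distrib norm_scale norm_inner_le
        mult_right_mono scaleR_conv_of_real scale_of_real flip: scale_scale mult.assoc)
  then have "bounded_linear (S M)" for M
    unfolding S_def by (intro bounded_linear_sum)
  moreover have "convergent (\<lambda>M. S M x)" for x
    using reconstruction_lim[of x] by (auto simp: S_def convergent_def)
  ultimately obtain C where C: "C > 0" "\<And>M x. norm (S M x) \<le> C * norm x"
    using uniformly_bounded_if_convergent[of S] by blast
  have "ip (A M x) y = ip x (S M y)" for M x y
  proof -
    have "ip x (S M y) = scalar_cnj (ip (S M y) x)"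
      by (rule inner_commute)
    also have "\<dots> = (\<Sum>n\<in>sect M. scalar_cnj (ip y (B (f n))) * scalar_cnj (ip (f n) x))"
      by (simp add: S_def inner_sum_left inner_scale_left scalar_cnj_sum scalar_cnj_mult)
    also have "\<dots> = ip (A M x) y"
      by (simp add: A_def inner_sum_left inner_scale_left mult.commute flip: inner_commute)
    finally show ?thesis ..
  qed
  then have adj: "re_inner (A M x) y = re_inner x (S M y)" for M x y
    by (simp add: re_inner_def)
  have A_le: "norm (A M x) \<le> C * norm x" for M x
  proof -
    \<comment> \<open>The adjoint relation is tested against \<open>A M x\<close> itself.\<close>
    have "norm (A M x) * norm (A M x) = re_inner x (S M (A M x))"
      by (simp add: adj[symmetric] re_inner_self power2_eq_square)
    also have "\<dots> \<le> norm x * (C * norm (A M x))"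
      by (rule order_trans[OF re_inner_le mult_left_mono[OF C(2)]]) simp
    finally have "norm (A M x) * norm (A M x) \<le> (C * norm x) * norm (A M x)"
      by (simp add: mult_ac)
    then show ?thesis
      using C(1) by (cases "A M x = 0") auto
  qed
  have "(\<lambda>M. A M h) \<longlonglongrightarrow> h"
  \<comment> \<open>One Lipschitz constant must serve both \<open>A M\<close> and the identity,
    hence \<open>max C 1\<close>.\<close>
  proof (rule LIMSEQ_dense[where \<psi> = "\<lambda>x. x" and C = "max C 1", OF _ _ dense_range])
    show "dist (A M x) (A M y) \<le> max C 1 * dist x y" for M x y
    proof -
      have "A M x - A M y = A M (x - y)"
        by (simp add: A_def inner_diff_left scale_left_diff_distrib sum_subtractf)
      then have "dist (A M x) (A M y) \<le> C * dist x y"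
        using A_le by (simp add: dist_norm)
      also have "\<dots> \<le> max C 1 * dist x y"
        by (simp add: mult_right_mono)
      finally show ?thesis .
    qed
    show "dist x y \<le> max C 1 * dist x y" for x y :: 'a
      using mult_right_mono[of 1 "max C 1" "dist x y"] by simp
    fix x assume "x \<in> range B"
    then obtain g where x: "x = B g" by blast
    \<comment> \<open>On the range of \<open>B\<close>, self-adjointness gives
      \<open>A M (B g) = B (S M g)\<close>.\<close>
    have "(\<lambda>M. B (S M g)) \<longlonglongrightarrow> B g"
      unfolding S_def by (rule bounded_linear.tendsto[OF bounded_linear_B reconstruction_lim])
    then show "(\<lambda>M. A M x) \<longlonglongrightarrow> x"
      by (simp add: A_def S_def x linear_sum[OF linear_B] B_scale self_adjoint)
  qed
  then show ?thesis
    by (simp add: A_def converges_along_def)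
qed

lemma parseval_positive_sqrt: "parseval_frame ip I (\<lambda>n. positive_sqrt scl ip B (f n))"
proof -
  define S where "S = positive_sqrt scl ip B"
  note S = positive_sqrt[OF psd bounded_operator, folded S_def]
  have SS: "S (S x) = B x" for x
    using S(3) by (auto simp: fun_eq_iff)
  have S_adj: "ip (S x) y = ip x (S y)" for x y
    using S(2) by (simp add: positive_semidefinite_def)
  \<comment> \<open>\<open>N M\<close> is the seminorm of the truncated coefficient sequence. It is
    at most the norm, hence 1-Lipschitz, so its limit need only be found on the range of
    \<open>S\<close>.\<close>
  define N where "N M h = L2_set (\<lambda>n. norm (ip h (S (f n)))) (sect M)" for M h
  have "range B \<subseteq> range S"
    using S(3) by auto
  then have dense: "closure (range S) = UNIV"
    using dense_range closure_mono by blast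
  have form: "re_inner (B g) g = (norm (S g))\<^sup>2" for g
    by (simp add: re_inner_self[symmetric] re_inner_def S_adj SS self_adjoint)
  have N_S: "N M (S g) = sqrt (\<Sum>n\<in>sect M. (norm (ip g (B (f n))))\<^sup>2)" for M g
    by (simp add: N_def L2_set_def S_adj SS)
  have N_lim: "(\<lambda>M. N M (S g)) \<longlonglongrightarrow> norm (S g)" for g
    unfolding N_S using tendsto_real_sqrt[OF quadratic_form_lim[of g]] by (simp add: form)
  have N_le: "N M h \<le> norm h" for M h
  proof -
    \<comment> \<open>The bound holds on the dense range of \<open>S\<close> and is a closed
      condition.\<close>
    have "closed {h. N M h \<le> norm h}"
      unfolding N_def L2_set_def
      by (intro closed_Collect_le continuous_intros linear_continuous_on bounded_linear_inner_left)
    moreover have "N M (S g) \<le> norm (S g)" for g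
    proof -
      have "(\<Sum>n\<in>sect M. (norm (ip g (B (f n))))\<^sup>2) \<le> (norm (S g))\<^sup>2"
        using finite_sum_le_has_sum[OF quadratic_form_has_sum[of g], of "sect M"]
        by (simp add: finite_symmetric_section form)
      then show ?thesis
        unfolding N_S by (simp add: real_le_lsqrt)
    qed
    ultimately have "closure (range S) \<subseteq> {h. N M h \<le> norm h}"
      by (intro closure_minimal) auto
    then show ?thesis
      using dense by auto
  qed
  have N_triangle: "N M x - N M y \<le> norm (x - y)" for M x y
  proof -
    have "N M x \<le> L2_set (\<lambda>n. norm (ip y (S (f n))) + norm (ip (x - y) (S (f n)))) (sect M)"
      unfolding N_def using norm_triangle_ineq
      by (intro L2_set_mono) (auto simp: inner_diff_left norm_triangle_sub)
    also have "\<dots> \<le> N M y + N M (x - y)"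
      unfolding N_def by (rule L2_set_triangle_ineq)
    finally show ?thesis
      using N_le[of M "x - y"] by simp
  qed
  have "(\<lambda>M. N M h) \<longlonglongrightarrow> norm h" for h
  proof (rule LIMSEQ_dense[where \<psi> = norm and C = 1, OF _ _ dense])
    show "dist (N M x) (N M y) \<le> 1 * dist x y" for M x y
      using N_triangle[of M x y] N_triangle[of M y x] by (simp add: dist_norm norm_minus_commute)
    show "dist (norm x) (norm y) \<le> 1 * dist x y" for x y :: 'a
      using norm_triangle_ineq3[of x y] by (simp add: dist_norm)
  qed (auto simp: N_lim)
  from tendsto_power[OF this, of _ 2]
  have "converges_along I (\<lambda>n. (norm (ip h (S (f n))))\<^sup>2) ((norm h)\<^sup>2)" for h
    by (simp add: N_def L2_set_def converges_along_def sum_nonneg)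
  then show ?thesis
    unfolding parseval_frame_def S_def[symmetric]
    by (intro allI converges_along_nonneg_imp_has_sum) simp_all
qed

end

text \<open>The two inequalities live in \<open>ennreal\<close>, so a divergent sum has the value
  \<open>top\<close>.\<close>

theorem theorem3p5:
  fixes scl :: "'k::real_or_complex \<Rightarrow> 'a::banach \<Rightarrow> 'a"
    and ip :: "'a \<Rightarrow> 'a \<Rightarrow> 'k"
    and I :: "int set"
    and f :: "int \<Rightarrow> 'a"
    and B :: "'a \<Rightarrow> 'a"
  assumes "hilbert_space scl ip"
    and "I = \<nat> \<or> I = \<int>"
    and "bounded_operator scl B"
    and "frame_reconstruction scl ip I f B"
  shows "(positive_semidefinite ip B \<and> inj B \<and> closure (range B) = UNIV) \<and>
    (\<forall>h. converges_along I (\<lambda>n. scl (ip h (f n)) (B (f n))) h \<and>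
         converges_along I (\<lambda>n. scl (ip (B h) (f n)) (f n)) h) \<and>
    (\<forall>h. (\<Sum>\<^sub>\<infinity>n\<in>I. ennreal ((norm (ip h (B (f n))))\<^sup>2)) \<le> ennreal (onorm B * (norm h)\<^sup>2)) \<and>
    (\<forall>h. ennreal (1 / onorm B * (norm h)\<^sup>2) \<le> (\<Sum>\<^sub>\<infinity>n\<in>I. ennreal ((norm (ip h (f n)))\<^sup>2))) \<and>
    parseval_frame ip I (\<lambda>n. positive_sqrt scl ip B (f n))"
proof -
  interpret reconstructing_frame scl ip I f B
    using assms by (simp add: reconstructing_frame_def reconstructing_frame_axioms_def)
  \<comment> \<open>The second expansion in (2) is the reconstruction hypothesis with
    \<open>B\<close> moved across the inner product.\<close>
  show ?thesis
    using reconstruction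
    by (simp add: psd inj_B dense_range adjoint_reconstruction upper_bound lower_bound
        parseval_positive_sqrt self_adjoint frame_reconstruction_def del: times_divide_eq_left)
qed

end
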